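(* Let $\{P_\theta:\theta\in\Theta\}$ be a general statistical experiment and $L(\theta_1,\theta_2)$ some loss function. Consider, for a rate $\mathcal{M}(\epsilon)$ and a constant $c>0$, the lower bound $$\inf_{\hat\theta}\sup_{\theta\in\Theta}\sup_Q\mathbb{P}_{(\epsilon,\theta,Q)}\left\{L(\hat\theta,\theta)\ge\mathcal{M}(\epsilon)\right\}\ge c.\qquad( * )$$ Suppose there is some $\mathcal{M}(0)$ such that $( * )$ holds for $\epsilon=0$. Then for any $\epsilon\in[0,1]$, $( * )$ holds for $\mathcal{M}(\epsilon)\asymp\mathcal{M}(0)\vee\omega(\epsilon,\Theta)$.
   Context: For $\epsilon\in[0,1]$, $\theta\in\Theta$ and a probability distribution $Q$ on the sample space, $\mathbb{P}_{(\epsilon,\theta,Q)}=(1-\epsilon)P_\theta+\epsilon Q$. One observes $X_1,\dots,X_n$ i.i.d. from $\mathbb{P}_{(\epsilon,\theta,Q)}$ (the same symbol denotes their joint law); the infimum is over all estimators $\hat\theta=\hat\theta(X_1,\dots,X_n)$ and $Q$ ranges over all probability distributions. The modulus of continuity is $$\omega(\epsilon,\Theta)=\sup\left\{L(\theta_1,\theta_2):\ \mathsf{TV}(P_{\theta_1},P_{\theta_2})\le\epsilon/(1-\epsilon);\ \theta_1,\theta_2\in\Theta\right\},$$ where $\mathsf{TV}(\mathbb{P},\mathbb{Q})=\sup_B|\mathbb{P}(B)-\mathbb{Q}(B)|$ is the total variation distance. $a\vee b=\max(a,b)$; $a_n\asymp b_n$ means $a_n\le Cb_n$ and $b_n\le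 Ca_n$ for some constant $C>0$ independent of $n$. The letter $c$ denotes a generic positive constant not depending on $n$, whose value may change from one occurrence to the next.
   Formalization: The loss is assumed nonnegative, measurable in the estimate, and to satisfy L(θ1,θ2) ≤ A(L(a,θ1)+L(a,θ2)) for every possible estimate a, with A independent of n; for an arbitrary loss the claim fails, e.g. if one estimate has zero loss everywhere. If ω is infinite, ( * ) holds for every finite M. *)

theory Defs
  imports "HOL-Probability.Probability"
begin

text \<open>A family of probability distributions on the sample space \<open>S\<close>, indexed by the elements
  of the parameter set \<open>\<Theta>\<close>.\<close>

definition statistical_experiment :: "'x measure \<Rightarrow> 't set \<Rightarrow> ('t \<Rightarrow> 'x measure) \<Rightarrow> bool" where
  "statistical_experiment S \<Theta> P \<longleftrightarrow> \<Theta> \<noteq> {} \<and> (\<forall>\<theta>\<in>\<Theta>. P \<theta> \<in> space (prob_algebra S))"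

text \<open>\<open>D\<close> is the measurable space in which estimators take their values. It contains \<open>\<Theta>\<close>,
  and may be equal to it; \<open>L a \<theta>\<close> is the loss of the estimate \<open>a\<close> when the
  parameter is \<open>\<theta>\<close>.\<close>

definition loss_function :: "'t measure \<Rightarrow> 't set \<Rightarrow> ('t \<Rightarrow> 't \<Rightarrow> real) \<Rightarrow> bool" where
  "loss_function D \<Theta> L \<longleftrightarrow>
     \<Theta> \<subseteq> space D \<and>
     (\<forall>a\<in>space D. \<forall>\<theta>\<in>\<Theta>. 0 \<le> L a \<theta>) \<and>
     (\<forall>\<theta>\<in>\<Theta>. (\<lambda>a. L a \<theta>) \<in> borel_measurable D)"

text \<open>The triangle inequality up to the factor \<open>A\<close>: \<open>A = 1\<close> for a metric, \<open>A = 2\<close> for the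
  square of a metric. The order of the arguments is such that symmetry of \<open>L\<close> is not needed.\<close>

definition quasi_triangle :: "'t measure \<Rightarrow> 't set \<Rightarrow> real \<Rightarrow> ('t \<Rightarrow> 't \<Rightarrow> real) \<Rightarrow> bool" where
  "quasi_triangle D \<Theta> A L \<longleftrightarrow>
     (\<forall>a\<in>space D. \<forall>\<theta>\<^sub>1\<in>\<Theta>. \<forall>\<theta>\<^sub>2\<in>\<Theta>. L \<theta>\<^sub>1 \<theta>\<^sub>2 \<le> A * (L a \<theta>\<^sub>1 + L a \<theta>\<^sub>2))"

definition contamination :: "real \<Rightarrow> 'x measure \<Rightarrow> 'x measure \<Rightarrow> 'x measure" where
  "contamination \<epsilon> P Q =
     measure_of (space P) (sets P)
       (\<lambda>B. ennreal (1 - \<epsilon>) * emeasure P B + ennreal \<epsilon> * emeasure Q B)"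

lemma sets_contamination [simp]: "sets (contamination \<epsilon> P Q) = sets P"
  by (simp add: contamination_def)

lemma emeasure_contamination:
  assumes "sets Q = sets P" "B \<in> sets P"
  shows "emeasure (contamination \<epsilon> P Q) B =
           ennreal (1 - \<epsilon>) * emeasure P B + ennreal \<epsilon> * emeasure Q B"
  unfolding contamination_def
proof (rule emeasure_measure_of_sigma)
  show "sigma_algebra (space P) (sets P)"
    by (rule sets.sigma_algebra_axioms)
  show "positive (sets P) (\<lambda>B. ennreal (1 - \<epsilon>) * emeasure P B + ennreal \<epsilon> * emeasure Q B)"
    by (simp add: positive_def)
  show "countably_additive (sets P)
          (\<lambda>B. ennreal (1 - \<epsilon>) * emeasure P B + ennreal \<epsilon> * emeasure Q B)"
    by (rule countably_additiveI)
      (simp add: suminf_add[symmetric] suminf_emeasure assms(1) ennreal_suminf_cmult)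
qed (fact assms(2))

definition TV :: "'x measure \<Rightarrow> 'x measure \<Rightarrow> real" where
  "TV P Q = (SUP B\<in>sets P. \<bar>measure P B - measure Q B\<bar>)"

text \<open>The threshold is an extended real so that it is \<open>\<infinity>\<close> for \<open>\<epsilon> = 1\<close> (in \<^typ>\<open>real\<close>
  it would be \<open>0\<close>). The modulus itself may be infinite.\<close>

definition modulus ::
    "real \<Rightarrow> 't set \<Rightarrow> ('t \<Rightarrow> 'x measure) \<Rightarrow> ('t \<Rightarrow> 't \<Rightarrow> real) \<Rightarrow> ereal" where
  "modulus \<epsilon> \<Theta> P L =
     Sup {ereal (L \<theta>\<^sub>1 \<theta>\<^sub>2) | \<theta>\<^sub>1 \<theta>\<^sub>2. \<theta>\<^sub>1 \<in> \<Theta> \<and> \<theta>\<^sub>2 \<in> \<Theta> \<and>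
       ereal (TV (P \<theta>\<^sub>1) (P \<theta>\<^sub>2)) \<le> ereal \<epsilon> / ereal (1 - \<epsilon>)}"

text \<open>\<open>minimax_prob n S D \<Theta> P L \<epsilon> m\<close> is the infimum over estimators based on \<open>n\<close> observations
  of the worst-case probability that the loss is at least \<open>m\<close>. It is taken in \<^typ>\<open>ennreal\<close>,
  where infima and suprema always exist.\<close>

definition minimax_prob ::
    "nat \<Rightarrow> 'x measure \<Rightarrow> 't measure \<Rightarrow> 't set \<Rightarrow> ('t \<Rightarrow> 'x measure) \<Rightarrow>
     ('t \<Rightarrow> 't \<Rightarrow> real) \<Rightarrow> real \<Rightarrow> real \<Rightarrow> ennreal" where
  "minimax_prob n S D \<Theta> P L \<epsilon> m =
     (INF est \<in> measurable (PiM {..<n} (\<lambda>_. S)) D.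
        SUP \<theta>\<in>\<Theta>. SUP Q\<in>space (prob_algebra S).
          emeasure (PiM {..<n} (\<lambda>_. contamination \<epsilon> (P \<theta>) Q))
            {x \<in> space (PiM {..<n} (\<lambda>_. S)). m \<le> L (est x) \<theta>})"

end

theory Submission
  imports Defs
begin

text \<open>
  A rate may be established at \<open>\<M>(0)\<close> and at \<open>\<omega>(\<epsilon>, \<Theta>)\<close> separately, since the larger of the two
  is always one of them.

  For \<open>\<M>(0)\<close>, the adversary may decide to contaminate \<open>P\<^sub>\<theta>\<close> with \<open>P\<^sub>\<theta>\<close> itself. The observations are then
  not contaminated at all, so the problem at level \<open>\<epsilon>\<close> is at least as hard as the one at level \<open>0\<close>
  (\<open>minimax_prob_mono_contamination\<close>).

  For \<open>\<omega>(\<epsilon>, \<Theta>)\<close>, let \<open>\<theta>\<^sub>1\<close> and \<open>\<theta>\<^sub>2\<close> be two parameters that nearly attain the modulus. The condition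
  \<open>TV \<le> \<epsilon> / (1 - \<epsilon>)\<close> is what lets the adversary choose contaminations \<open>Q\<^sub>1\<close> and \<open>Q\<^sub>2\<close> that make the
  two laws identical: with densities \<open>f\<^sub>1\<close> and \<open>f\<^sub>2\<close>, the measure with density
  \<open>(1 - \<epsilon>) max f\<^sub>1 f\<^sub>2\<close> dominates both \<open>(1 - \<epsilon>) P\<^sub>\<theta>\<^sub>1\<close> and \<open>(1 - \<epsilon>) P\<^sub>\<theta>\<^sub>2\<close> and its total mass
  \<open>(1 - \<epsilon>) (1 + TV)\<close> is at most \<open>1\<close>
  (\<open>exists_common_contamination\<close>). The data then carry no information on which of the two
  parameters is the true one. By the quasi-triangle inequality every estimate has loss at least
  \<open>L \<theta>\<^sub>1 \<theta>\<^sub>2 / (2 A)\<close> for one of them, so that one of the two error events has probability at least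
  one half (\<open>minimax_prob_ge_half\<close>). This holds for every \<open>n\<close>, because equality of the
  one-observation laws gives equality of the product laws.

  The supremum in the modulus need not be attained, and halving it once more leaves room to choose
  the pair: the rate is \<open>\<omega>(\<epsilon>, \<Theta>) / (4 A)\<close>. An infinite modulus provides pairs with
  arbitrarily large loss, and so defeats every threshold.
\<close>

section \<open>Contaminated distributions\<close>

lemma space_contamination [simp]: "space (contamination \<epsilon> P Q) = space P"
  by (simp add: contamination_def)

lemma contamination_in_prob_algebra:
  assumes "\<epsilon> \<in> {0..1}" "P \<in> space (prob_algebra S)" "Q \<in> space (prob_algebra S)"
  shows "contamination \<epsilon> P Q \<in> space (prob_algebra S)"
proof -
  have sets: "sets P = sets S" "sets Q = sets P" and prob: "prob_space P" "prob_space Q"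
    using assms(2,3) by (auto simp: space_prob_algebra)
  have space: "space Q = space P"
    using sets(2) by (rule sets_eq_imp_space_eq)
  have "emeasure (contamination \<epsilon> P Q) (space P) = ennreal (1 - \<epsilon>) + ennreal \<epsilon>"
    using prob_space.emeasure_space_1[OF prob(1)] prob_space.emeasure_space_1[OF prob(2)] space
    by (simp add: emeasure_contamination[OF sets(2)])
  also have "\<dots> = 1"
    using assms(1) by (simp flip: ennreal_plus)
  finally show ?thesis
    using sets by (auto simp: space_prob_algebra intro!: prob_spaceI)
qed

text \<open>Contaminating a distribution with itself is the adversary's option of doing nothing.\<close>

lemma contamination_self:
  assumes "\<epsilon> \<in> {0..1}"
  shows "contamination \<epsilon> P P = P"
proof (rule measure_eqI)
  fix B assume "B \<in> sets (contamination \<epsilon> P P)"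
  then have "emeasure (contamination \<epsilon> P P) B = (ennreal (1 - \<epsilon>) + ennreal \<epsilon>) * emeasure P B"
    by (simp add: emeasure_contamination distrib_right)
  also have "ennreal (1 - \<epsilon>) + ennreal \<epsilon> = 1"
    using assms by (simp flip: ennreal_plus)
  finally show "emeasure (contamination \<epsilon> P P) B = emeasure P B"
    by simp
qed simp

lemma contamination_zero:
  assumes "sets Q = sets P"
  shows "contamination 0 P Q = P"
  by (rule measure_eqI) (simp_all add: emeasure_contamination[OF assms])

lemma contamination_density:
  fixes f g :: "'x \<Rightarrow> real"
  assumes [measurable]: "f \<in> borel_measurable M" "g \<in> borel_measurable M"
    and "\<And>x. 0 \<le> f x" "\<And>x. 0 \<le> g x" "\<epsilon> \<in> {0..1}"
  shows "contamination \<epsilon> (density M f) (density M g) =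
           density M (\<lambda>x. (1 - \<epsilon>) * f x + \<epsilon> * g x)"
proof (rule measure_eqI)
  fix B assume "B \<in> sets (contamination \<epsilon> (density M f) (density M g))"
  then have B [measurable]: "B \<in> sets M"
    by simp
  have "emeasure (contamination \<epsilon> (density M f) (density M g)) B =
      (\<integral>\<^sup>+x. ennreal (1 - \<epsilon>) * (ennreal (f x) * indicator B x)
         + ennreal \<epsilon> * (ennreal (g x) * indicator B x) \<partial>M)"
    by (simp add: emeasure_contamination emeasure_density nn_integral_add nn_integral_cmult)
  also have "\<dots> = (\<integral>\<^sup>+x. ennreal ((1 - \<epsilon>) * f x + \<epsilon> * g x) * indicator B x \<partial>M)"
    using assms(3-5)
    by (intro nn_integral_cong) (auto simp: ennreal_plus ennreal_mult split: split_indicator)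
  also have "\<dots> = emeasure (density M (\<lambda>x. (1 - \<epsilon>) * f x + \<epsilon> * g x)) B"
    by (simp add: emeasure_density)
  finally show "emeasure (contamination \<epsilon> (density M f) (density M g)) B =
      emeasure (density M (\<lambda>x. (1 - \<epsilon>) * f x + \<epsilon> * g x)) B" .
qed simp

section \<open>Total variation and densities\<close>

text \<open>The point is that the supremum defining \<^const>\<open>TV\<close> is over a bounded set; a supremum of
  an unbounded set of reals would be an arbitrary number.\<close>

lemma abs_measure_diff_le_TV:
  assumes "prob_space P" "prob_space Q" "B \<in> sets P"
  shows "\<bar>measure P B - measure Q B\<bar> \<le> TV P Q"
  unfolding TV_def
proof (rule cSUP_upper[OF assms(3)])
  have "\<bar>measure P B - measure Q B\<bar> \<le> 1" for B
    using prob_space.prob_le_1[OF assms(1), of B] prob_space.prob_le_1[OF assms(2), of B]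
      measure_nonneg[of P B] measure_nonneg[of Q B] by linarith
  then show "bdd_above ((\<lambda>B. \<bar>measure P B - measure Q B\<bar>) ` sets P)"
    by (auto intro!: bdd_aboveI)
qed

lemma TV_self: "TV P P = 0"
proof -
  have "sets P \<noteq> {}" by auto
  then show ?thesis by (simp add: TV_def)
qed

text \<open>A parameter always competes with itself in the modulus. This makes the modulus nonnegative and
  provides the two-point bound for a vanishing modulus.\<close>

lemma TV_self_le_threshold:
  assumes "\<epsilon> \<in> {0..1}"
  shows "ereal (TV P P) \<le> ereal \<epsilon> / ereal (1 - \<epsilon>)"
  using assms by (cases "\<epsilon> = 1") (auto simp: TV_self)

text \<open>Both distributions are absolutely continuous with respect to their average, which
  serves as the dominating measure. The densities are taken in the reals, where they can be
  subtracted; the type of \<open>borel\<close> is given explicitly because otherwise \<open>f\<close> and \<open>g\<close> would be coerced to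
  \<^typ>\<open>ennreal\<close>.\<close>

lemma common_dominating_densities:
  assumes "P \<in> space (prob_algebra S)" "Q \<in> space (prob_algebra S)"
  obtains M and f g :: "'x \<Rightarrow> real" where
    "sets M = sets S" "f \<in> measurable M (borel :: real measure)" "g \<in> measurable M (borel :: real measure)"
    "\<And>x. 0 \<le> f x" "\<And>x. 0 \<le> g x" "P = density M f" "Q = density M g"
proof -
  define M where "M = contamination (1/2) P Q"
  have sets: "sets P = sets S" "sets Q = sets P" and prob: "prob_space P" "prob_space Q"
    using assms by (auto simp: space_prob_algebra)
  have setsM: "sets M = sets P"
    by (simp add: M_def)
  have "M \<in> space (prob_algebra S)"
    unfolding M_def using assms by (intro contamination_in_prob_algebra) auto
  then interpret M: prob_space M
    by (simp add: space_prob_algebra)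
  have ac: "absolutely_continuous M P" "absolutely_continuous M Q"
    using emeasure_contamination[OF sets(2), of _ "1/2"] sets
    by (auto simp: absolutely_continuous_def null_sets_def M_def)
  have ex: "\<exists>f :: 'x \<Rightarrow> real. f \<in> measurable M (borel :: real measure) \<and> (\<forall>x. 0 \<le> f x) \<and> N = density M f"
    if N: "prob_space N" "absolutely_continuous M N" "sets N = sets M" for N
  proof -
    interpret N: prob_space N by fact
    obtain h where h: "h \<in> borel_measurable M" "AE x in M. RN_deriv M N x = ennreal (h x)"
        "\<And>x. 0 \<le> h x"
      using M.real_RN_deriv[OF N.finite_measure_axioms N(2,3)] by blast
    have "density M h = density M (RN_deriv M N)"
      using h by (intro density_cong) auto
    also have "\<dots> = N"
      using M.density_RN_deriv[OF N(2,3)] .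
    finally show ?thesis using h by auto
  qed
  obtain f :: "'x \<Rightarrow> real" where f: "f \<in> borel_measurable M" "\<forall>x. 0 \<le> f x" "P = density M f"
    using ex[OF prob(1) ac(1) setsM[symmetric]] by (elim exE conjE)
  obtain g :: "'x \<Rightarrow> real" where g: "g \<in> borel_measurable M" "\<forall>x. 0 \<le> g x" "Q = density M g"
    using ex[OF prob(2) ac(2)] sets(2) setsM by auto
  show thesis
  proof (rule that)
    show "sets M = sets S" using sets(1) setsM by simp
  qed (use f g in auto)
qed

lemma density_in_prob_algebra_iff:
  fixes f :: "'x \<Rightarrow> real"
  assumes "sets M = sets S" "f \<in> borel_measurable M" "\<And>x. 0 \<le> f x"
  shows "density M f \<in> space (prob_algebra S) \<longleftrightarrow> has_bochner_integral M f 1"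
proof -
  have "emeasure (density M f) (space (density M f)) = (\<integral>\<^sup>+x. ennreal (f x) * indicator (space M) x \<partial>M)"
    using assms(2) by (simp add: emeasure_density)
  also have "\<dots> = (\<integral>\<^sup>+x. ennreal (f x) \<partial>M)"
    by (intro nn_integral_cong) simp
  finally have "prob_space (density M f) \<longleftrightarrow> (\<integral>\<^sup>+x. f x \<partial>M) = ennreal 1"
    by (metis ennreal_1 prob_space.emeasure_space_1 prob_spaceI)
  then have "density M f \<in> space (prob_algebra S) \<longleftrightarrow> (\<integral>\<^sup>+x. f x \<partial>M) = ennreal 1"
    using assms(1) by (simp add: space_prob_algebra)
  also have "\<dots> \<longleftrightarrow> has_bochner_integral M f 1"
    using assms(2,3) nn_integral_eq_integrable[of f M 1] by (simp add: has_bochner_integral_iff)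
  finally show ?thesis .
qed

lemma measure_density_eq_integral:
  fixes f :: "'x \<Rightarrow> real"
  assumes "integrable M f" "\<And>x. 0 \<le> f x" "B \<in> sets M"
  shows "measure (density M f) B = (\<integral>x. f x * indicator B x \<partial>M)"
proof -
  have "emeasure (density M f) B = (\<integral>\<^sup>+x. ennreal (f x * indicator B x) \<partial>M)"
    using assms by (auto simp: emeasure_density intro!: nn_integral_cong split: split_indicator)
  also have "\<dots> = ennreal (\<integral>x. f x * indicator B x \<partial>M)"
    using assms by (intro nn_integral_eq_integral integrable_real_mult_indicator) auto
  finally show ?thesis
    using assms(2) by (simp add: measure_def)
qed

text \<open>The event \<open>B\<close> on which \<open>g\<close> exceeds \<open>f\<close> turns the integral of the maximum into
  \<open>1\<close> plus the difference of the two probabilities of \<open>B\<close>, and \<open>B\<close> is one of the events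
  over which \<^const>\<open>TV\<close> takes its supremum.\<close>

lemma integral_max_densities_le_TV:
  fixes f g :: "'x \<Rightarrow> real"
  assumes nonneg: "\<And>x. 0 \<le> f x" "\<And>x. 0 \<le> g x"
    and int: "has_bochner_integral M f 1" "has_bochner_integral M g 1"
  shows "(\<integral>x. max (f x) (g x) \<partial>M) \<le> 1 + TV (density M f) (density M g)"
proof -
  define B where "B = {x \<in> space M. f x < g x}"
  have integrable [simp]: "integrable M f" "integrable M g"
    and one: "integral\<^sup>L M f = 1" "integral\<^sup>L M g = 1"
    using int by (auto simp: has_bochner_integral_iff)
  have [measurable]: "f \<in> borel_measurable M" "g \<in> borel_measurable M"
    using borel_measurable_integrable integrable by blast+
  have B [measurable]: "B \<in> sets M"
    unfolding B_def by measurable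
  have ind: "integrable M (\<lambda>x. f x * indicator B x)" "integrable M (\<lambda>x. g x * indicator B x)"
    using B by (auto intro!: integrable_real_mult_indicator)
  have prob: "prob_space (density M f)" "prob_space (density M g)"
    using density_in_prob_algebra_iff[of M M f] density_in_prob_algebra_iff[of M M g] nonneg int
    by (auto simp: space_prob_algebra)
  have "(\<integral>x. max (f x) (g x) \<partial>M)
      = (\<integral>x. f x + (g x * indicator B x - f x * indicator B x) \<partial>M)"
    by (rule Bochner_Integration.integral_cong) (auto simp: B_def max_def split: split_indicator)
  also have "\<dots> = 1 + (measure (density M g) B - measure (density M f) B)"
    using ind one nonneg by (simp add: measure_density_eq_integral)
  also have "\<dots> \<le> 1 + TV (density M f) (density M g)"
    using abs_measure_diff_le_TV[OF prob, of B] by simp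
  finally show ?thesis .
qed

lemma TV_eq_0_imp_eq:
  assumes "P \<in> space (prob_algebra S)" "Q \<in> space (prob_algebra S)" "TV P Q \<le> 0"
  shows "P = Q"
proof -
  interpret P: prob_space P using assms by (simp add: space_prob_algebra)
  interpret Q: prob_space Q using assms by (simp add: space_prob_algebra)
  show ?thesis
  proof (rule measure_eqI)
    fix B assume "B \<in> sets P"
    then have "\<bar>measure P B - measure Q B\<bar> \<le> TV P Q"
      by (intro abs_measure_diff_le_TV P.prob_space_axioms Q.prob_space_axioms)
    then show "emeasure P B = emeasure Q B"
      using assms(3) by (simp add: P.emeasure_eq_measure Q.emeasure_eq_measure)
  qed (use assms in \<open>simp add: space_prob_algebra\<close>)
qed

text \<open>The common law is obtained by raising both \<open>(1 - \<epsilon>) f\<^sub>1\<close> and \<open>(1 - \<epsilon>) f\<^sub>2\<close> to their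
  maximum. This takes no more than the budget \<open>\<epsilon>\<close>; whatever is left of the budget can
  be spent in any way that is the same on both sides. Each \<open>Q\<^sub>i\<close> is the normalised difference between
  the common law and \<open>(1 - \<epsilon>) P\<^sub>i\<close>. For \<open>\<epsilon> = 0\<close> there is nothing to normalise, but then
  the two distributions already agree.\<close>

lemma exists_common_contamination:
  assumes \<epsilon>: "\<epsilon> \<in> {0..1}"
    and P: "P\<^sub>1 \<in> space (prob_algebra S)" "P\<^sub>2 \<in> space (prob_algebra S)"
    and TV: "(1 - \<epsilon>) * TV P\<^sub>1 P\<^sub>2 \<le> \<epsilon>"
  shows "\<exists>Q\<^sub>1\<in>space (prob_algebra S). \<exists>Q\<^sub>2\<in>space (prob_algebra S).
           contamination \<epsilon> P\<^sub>1 Q\<^sub>1 = contamination \<epsilon> P\<^sub>2 Q\<^sub>2"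
proof (cases "\<epsilon> = 0")
  case True
  then have "P\<^sub>1 = P\<^sub>2"
    using TV by (intro TV_eq_0_imp_eq[OF P]) simp
  then show ?thesis
    using P by auto
next
  case False
  then have pos: "0 < \<epsilon>" "0 \<le> 1 - \<epsilon>"
    using \<epsilon> by auto
  obtain M f\<^sub>1 f\<^sub>2 where M: "sets M = sets S"
    and [measurable]: "f\<^sub>1 \<in> measurable M (borel :: real measure)" "f\<^sub>2 \<in> measurable M (borel :: real measure)"
    and nonneg: "\<And>x. 0 \<le> f\<^sub>1 x" "\<And>x. 0 \<le> f\<^sub>2 x"
    and dens: "P\<^sub>1 = density M f\<^sub>1" "P\<^sub>2 = density M f\<^sub>2"
    using common_dominating_densities[OF P] by blast
  have int: "has_bochner_integral M f\<^sub>1 1" "has_bochner_integral M f\<^sub>2 1"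
    using P nonneg density_in_prob_algebra_iff[OF M] by (simp_all add: dens)
  define t where "t = (\<integral>x. max (f\<^sub>1 x) (f\<^sub>2 x) \<partial>M) - 1"
  \<comment> \<open>\<open>t\<close> is the integral formula for the total variation distance; \<open>k\<close> is the mass left over
      when the maximum of the densities has been reached, and it is put on \<open>P\<^sub>1\<close>.\<close>
  define k where "k = \<epsilon> - (1 - \<epsilon>) * t"
  define h where "h x = (1 - \<epsilon>) * max (f\<^sub>1 x) (f\<^sub>2 x) + k * f\<^sub>1 x" for x
  have "t \<le> TV P\<^sub>1 P\<^sub>2"
    using integral_max_densities_le_TV[OF nonneg int] by (simp add: t_def dens)
  then have "(1 - \<epsilon>) * t \<le> \<epsilon>"
    using TV mult_left_mono[OF _ pos(2), of t "TV P\<^sub>1 P\<^sub>2"] by linarith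
  then have k: "0 \<le> k"
    by (simp add: k_def)
  have [measurable]: "h \<in> borel_measurable M"
    unfolding h_def by measurable
  have "has_bochner_integral M (\<lambda>x. max (f\<^sub>1 x) (f\<^sub>2 x)) (1 + t)"
    using int by (auto simp: has_bochner_integral_iff t_def)
  then have "has_bochner_integral M h ((1 - \<epsilon>) * (1 + t) + k * 1)"
    unfolding h_def using int by (intro has_bochner_integral_add has_bochner_integral_mult_right) auto
  then have h: "has_bochner_integral M h 1"
    by (simp add: k_def algebra_simps)
  have Q: "\<exists>Q\<in>space (prob_algebra S). contamination \<epsilon> (density M f) Q = density M h"
    if [measurable]: "f \<in> borel_measurable M" and f: "\<And>x. 0 \<le> f x" "\<And>x. f x \<le> max (f\<^sub>1 x) (f\<^sub>2 x)"
      "has_bochner_integral M f 1" for f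
  proof -
    define g where "g x = (h x - (1 - \<epsilon>) * f x) / \<epsilon>" for x
    have [measurable]: "g \<in> borel_measurable M"
      unfolding g_def by measurable
    have "(1 - \<epsilon>) * f x \<le> h x" for x
      using mult_left_mono[OF f(2) pos(2), of x] mult_nonneg_nonneg[OF k nonneg(1), of x]
      by (simp add: h_def)
    then have g: "0 \<le> g x" for x
      using pos by (simp add: g_def)
    have "has_bochner_integral M g ((1 - (1 - \<epsilon>) * 1) / \<epsilon>)"
      unfolding g_def using h f(3) pos
      by (intro has_bochner_integral_divide has_bochner_integral_diff has_bochner_integral_mult_right) auto
    then have "density M g \<in> space (prob_algebra S)"
      using pos g density_in_prob_algebra_iff[OF M] by simp
    moreover have "contamination \<epsilon> (density M f) (density M g) = density M h"
    proof -
      have "(1 - \<epsilon>) * f x + \<epsilon> * g x = h x" for x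
        using pos by (simp add: g_def)
      then show ?thesis
        using \<epsilon> f(1) g by (subst contamination_density) auto
    qed
    ultimately show ?thesis by blast
  qed
  obtain Q\<^sub>1 Q\<^sub>2 where "Q\<^sub>1 \<in> space (prob_algebra S)" "contamination \<epsilon> P\<^sub>1 Q\<^sub>1 = density M h"
    "Q\<^sub>2 \<in> space (prob_algebra S)" "contamination \<epsilon> P\<^sub>2 Q\<^sub>2 = density M h"
    using Q[of f\<^sub>1] Q[of f\<^sub>2] nonneg int unfolding dens by auto
  then show ?thesis by (metis (no_types))
qed

section \<open>The modulus of continuity\<close>

text \<open>The product form also covers \<open>\<epsilon> = 1\<close>, where the threshold is infinite.\<close>

lemma le_threshold_imp_mult_le:
  assumes "\<epsilon> \<in> {0..1}" "ereal t \<le> ereal \<epsilon> / ereal (1 - \<epsilon>)"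
  shows "(1 - \<epsilon>) * t \<le> \<epsilon>"
proof (cases "\<epsilon> = 1")
  case False
  with assms show ?thesis by (simp add: field_simps)
qed simp

lemma modulus_nonneg:
  assumes "\<epsilon> \<in> {0..1}" "\<Theta> \<noteq> {}" "loss_function D \<Theta> L"
  shows "0 \<le> modulus \<epsilon> \<Theta> P L"
proof -
  obtain \<theta> where \<theta>: "\<theta> \<in> \<Theta>" using assms(2) by auto
  have "0 \<le> ereal (L \<theta> \<theta>)"
    using \<theta> assms(3) by (auto simp: loss_function_def)
  moreover have "ereal (L \<theta> \<theta>) \<le> modulus \<epsilon> \<Theta> P L"
    unfolding modulus_def using \<theta> TV_self_le_threshold[OF assms(1)] by (intro Sup_upper) blast
  ultimately show ?thesis by (rule order_trans)
qed

section \<open>Lower bounds for the minimax probability\<close>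

text \<open>At level \<open>0\<close> each observation has law \<open>P \<theta>\<close>, and at level \<open>\<epsilon>\<close> the choice \<open>Q = P \<theta>\<close>
  reproduces this law.\<close>

lemma minimax_prob_mono_contamination:
  assumes "\<epsilon> \<in> {0..1}" and P: "\<And>\<theta>. \<theta> \<in> \<Theta> \<Longrightarrow> P \<theta> \<in> space (prob_algebra S)"
  shows "minimax_prob n S D \<Theta> P L 0 m \<le> minimax_prob n S D \<Theta> P L \<epsilon> m"
  unfolding minimax_prob_def
proof (intro INF_mono' SUP_least)
  fix est \<theta> Q assume \<theta>: "\<theta> \<in> \<Theta>" and Q: "Q \<in> space (prob_algebra S)"
  let ?E = "{x \<in> space (PiM {..<n} (\<lambda>_. S)). m \<le> L (est x) \<theta>}"
  have "sets Q = sets (P \<theta>)"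
    using P[OF \<theta>] Q by (simp add: space_prob_algebra)
  then have "emeasure (PiM {..<n} (\<lambda>_. contamination 0 (P \<theta>) Q)) ?E
      = emeasure (PiM {..<n} (\<lambda>_. contamination \<epsilon> (P \<theta>) (P \<theta>))) ?E"
    using assms(1) by (simp add: contamination_zero contamination_self)
  also have "\<dots> \<le> (SUP Q\<in>space (prob_algebra S).
      emeasure (PiM {..<n} (\<lambda>_. contamination \<epsilon> (P \<theta>) Q)) ?E)"
    by (rule SUP_upper[OF P[OF \<theta>]])
  also have "\<dots> \<le> (SUP \<theta>\<in>\<Theta>. SUP Q\<in>space (prob_algebra S).
      emeasure (PiM {..<n} (\<lambda>_. contamination \<epsilon> (P \<theta>) Q))
        {x \<in> space (PiM {..<n} (\<lambda>_. S)). m \<le> L (est x) \<theta>})"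
    by (rule SUP_upper[OF \<theta>])
  finally show "emeasure (PiM {..<n} (\<lambda>_. contamination 0 (P \<theta>) Q)) ?E \<le> \<dots>" .
qed

text \<open>Le Cam's two-point argument for identical laws: under the common law the two error events cover the
  sample space, so one of them has probability at least one half.\<close>

lemma minimax_prob_ge_half:
  assumes \<epsilon>: "\<epsilon> \<in> {0..1}"
    and P: "\<And>\<theta>. \<theta> \<in> \<Theta> \<Longrightarrow> P \<theta> \<in> space (prob_algebra S)"
    and loss: "loss_function D \<Theta> L" and tri: "quasi_triangle D \<Theta> A L" and A: "A > 0"
    and \<theta>: "\<theta>\<^sub>1 \<in> \<Theta>" "\<theta>\<^sub>2 \<in> \<Theta>"
    and TV: "ereal (TV (P \<theta>\<^sub>1) (P \<theta>\<^sub>2)) \<le> ereal \<epsilon> / ereal (1 - \<epsilon>)"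
    and m: "2 * A * m \<le> L \<theta>\<^sub>1 \<theta>\<^sub>2"
  shows "ennreal (1 / 2) \<le> minimax_prob n S D \<Theta> P L \<epsilon> m"
  unfolding minimax_prob_def
proof (rule INF_greatest)
  fix est assume [measurable]: "est \<in> measurable (PiM {..<n} (\<lambda>_. S)) D"
  define E where "E \<theta> = {x \<in> space (PiM {..<n} (\<lambda>_. S)). m \<le> L (est x) \<theta>}" for \<theta>
  obtain Q\<^sub>1 Q\<^sub>2 where Q: "Q\<^sub>1 \<in> space (prob_algebra S)" "Q\<^sub>2 \<in> space (prob_algebra S)"
    and eq: "contamination \<epsilon> (P \<theta>\<^sub>1) Q\<^sub>1 = contamination \<epsilon> (P \<theta>\<^sub>2) Q\<^sub>2"
    using exists_common_contamination[OF \<epsilon> P[OF \<theta>(1)] P[OF \<theta>(2)] le_threshold_imp_mult_le[OF \<epsilon> TV]]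
    by blast
  define R where "R = contamination \<epsilon> (P \<theta>\<^sub>1) Q\<^sub>1"
  have R: "R \<in> space (prob_algebra S)"
    unfolding R_def by (rule contamination_in_prob_algebra[OF \<epsilon> P[OF \<theta>(1)] Q(1)])
  define Rn where "Rn = PiM {..<n} (\<lambda>_. R)"
  have sets_Rn: "sets Rn = sets (PiM {..<n} (\<lambda>_. S))"
    using R unfolding Rn_def by (intro sets_PiM_cong) (auto simp: space_prob_algebra)
  interpret Rn: prob_space Rn
    using R unfolding Rn_def by (intro prob_space_PiM) (simp add: space_prob_algebra)
  have E: "E \<theta> \<in> sets Rn" if "\<theta> \<in> \<Theta>" for \<theta>
  proof -
    have [measurable]: "(\<lambda>a. L a \<theta>) \<in> borel_measurable D"
      using loss that by (simp add: loss_function_def)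
    show ?thesis unfolding E_def sets_Rn by measurable
  qed
  have "space Rn \<subseteq> E \<theta>\<^sub>1 \<union> E \<theta>\<^sub>2"
  proof
    fix x assume "x \<in> space Rn"
    then have x: "x \<in> space (PiM {..<n} (\<lambda>_. S))"
      using sets_eq_imp_space_eq[OF sets_Rn] by simp
    then have "est x \<in> space D"
      by (rule measurable_space[rotated]) measurable
    then have "L \<theta>\<^sub>1 \<theta>\<^sub>2 \<le> A * (L (est x) \<theta>\<^sub>1 + L (est x) \<theta>\<^sub>2)"
      using tri \<theta> by (simp add: quasi_triangle_def)
    then have "A * (2 * m) \<le> A * (L (est x) \<theta>\<^sub>1 + L (est x) \<theta>\<^sub>2)"
      using m by (simp add: mult_ac)
    then have "2 * m \<le> L (est x) \<theta>\<^sub>1 + L (est x) \<theta>\<^sub>2"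
      using A by simp
    then show "x \<in> E \<theta>\<^sub>1 \<union> E \<theta>\<^sub>2"
      using x by (auto simp: E_def)
  qed
  then have "Rn.prob (space Rn) \<le> Rn.prob (E \<theta>\<^sub>1 \<union> E \<theta>\<^sub>2)"
    using E \<theta> by (intro Rn.finite_measure_mono) auto
  also have "\<dots> \<le> Rn.prob (E \<theta>\<^sub>1) + Rn.prob (E \<theta>\<^sub>2)"
    using E \<theta> by (intro measure_Un_le) auto
  finally have "1 / 2 \<le> Rn.prob (E \<theta>\<^sub>1) \<or> 1 / 2 \<le> Rn.prob (E \<theta>\<^sub>2)"
    by (auto simp: Rn.prob_space)
  then obtain \<theta> Q where \<theta>Q: "\<theta> \<in> \<Theta>" "Q \<in> space (prob_algebra S)"
    "contamination \<epsilon> (P \<theta>) Q = R" "1 / 2 \<le> Rn.prob (E \<theta>)"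
    using \<theta> Q eq R_def by metis
  have "ennreal (1 / 2) \<le> emeasure Rn (E \<theta>)"
    using \<theta>Q(4) unfolding Rn.emeasure_eq_measure by (rule ennreal_leI)
  also have "\<dots> = emeasure (PiM {..<n} (\<lambda>_. contamination \<epsilon> (P \<theta>) Q)) (E \<theta>)"
    using \<theta>Q(3) by (simp add: Rn_def)
  also have "\<dots> \<le> (SUP Q\<in>space (prob_algebra S).
      emeasure (PiM {..<n} (\<lambda>_. contamination \<epsilon> (P \<theta>) Q)) (E \<theta>))"
    by (rule SUP_upper[OF \<theta>Q(2)])
  also have "\<dots> \<le> (SUP \<theta>\<in>\<Theta>. SUP Q\<in>space (prob_algebra S).
      emeasure (PiM {..<n} (\<lambda>_. contamination \<epsilon> (P \<theta>) Q)) (E \<theta>))"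
    by (rule SUP_upper[OF \<theta>Q(1)])
  finally show "ennreal (1 / 2) \<le> (SUP \<theta>\<in>\<Theta>. SUP Q\<in>space (prob_algebra S).
      emeasure (PiM {..<n} (\<lambda>_. contamination \<epsilon> (P \<theta>) Q))
        {x \<in> space (PiM {..<n} (\<lambda>_. S)). m \<le> L (est x) \<theta>})"
    unfolding E_def .
qed

text \<open>The strict inequality provides a pair of parameters even when the supremum is not attained,
  and it makes the bound apply to every real \<open>m\<close> when the modulus is infinite.\<close>

lemma minimax_prob_ge_half_below_modulus:
  assumes \<epsilon>: "\<epsilon> \<in> {0..1}"
    and P: "\<And>\<theta>. \<theta> \<in> \<Theta> \<Longrightarrow> P \<theta> \<in> space (prob_algebra S)"
    and loss: "loss_function D \<Theta> L" and tri: "quasi_triangle D \<Theta> A L" and A: "A > 0"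
    and m: "ereal (2 * A * m) < modulus \<epsilon> \<Theta> P L"
  shows "ennreal (1 / 2) \<le> minimax_prob n S D \<Theta> P L \<epsilon> m"
proof -
  obtain \<theta>\<^sub>1 \<theta>\<^sub>2 where \<theta>: "\<theta>\<^sub>1 \<in> \<Theta>" "\<theta>\<^sub>2 \<in> \<Theta>"
      "ereal (TV (P \<theta>\<^sub>1) (P \<theta>\<^sub>2)) \<le> ereal \<epsilon> / ereal (1 - \<epsilon>)"
    and "ereal (2 * A * m) < ereal (L \<theta>\<^sub>1 \<theta>\<^sub>2)"
    using m unfolding modulus_def less_Sup_iff by blast
  then show ?thesis
    by (intro minimax_prob_ge_half[OF \<epsilon> P loss tri A \<theta>]) auto
qed

text \<open>The rate is \<open>M0\<close> when it is at least the modulus, and the modulus divided by \<open>4 A\<close> otherwise.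
  The constant \<open>C\<close> compares the latter with the modulus in both directions, and has to be at least
  \<open>1\<close> for the former.\<close>

theorem theorem5p1:
  fixes S :: "nat \<Rightarrow> 'x measure"
    and D :: "nat \<Rightarrow> 't measure"
    and \<Theta> :: "nat \<Rightarrow> 't set"
    and P :: "nat \<Rightarrow> 't \<Rightarrow> 'x measure"
    and L :: "nat \<Rightarrow> 't \<Rightarrow> 't \<Rightarrow> real"
    and A c :: real
    and M0 :: "nat \<Rightarrow> real"
  assumes "\<And>n. n \<ge> 1 \<Longrightarrow> statistical_experiment (S n) (\<Theta> n) (P n)"
    and "\<And>n. n \<ge> 1 \<Longrightarrow> loss_function (D n) (\<Theta> n) (L n)"
    and "A > 0"
    and "\<And>n. n \<ge> 1 \<Longrightarrow> quasi_triangle (D n) (\<Theta> n) A (L n)"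
    and "c > 0"
    and "\<And>n. n \<ge> 1 \<Longrightarrow> minimax_prob n (S n) (D n) (\<Theta> n) (P n) (L n) 0 (M0 n) \<ge> ennreal c"
  shows "\<exists>C>0. \<exists>c'>0. \<forall>n\<ge>1. \<forall>\<epsilon>\<in>{0..1}.
           (modulus \<epsilon> (\<Theta> n) (P n) (L n) < \<infinity> \<longrightarrow>
             (\<exists>M::real.
               ereal M \<le> ereal C * max (ereal (M0 n)) (modulus \<epsilon> (\<Theta> n) (P n) (L n)) \<and>
               max (ereal (M0 n)) (modulus \<epsilon> (\<Theta> n) (P n) (L n)) \<le> ereal C * ereal M \<and>
               minimax_prob n (S n) (D n) (\<Theta> n) (P n) (L n) \<epsilon> M \<ge> ennreal c')) \<and>
           (modulus \<epsilon> (\<Theta> n) (P n) (L n) = \<infinity> \<longrightarrow>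
             (\<forall>M::real. minimax_prob n (S n) (D n) (\<Theta> n) (P n) (L n) \<epsilon> M \<ge> ennreal c'))"
proof -
  define C where "C = max 1 (max (4 * A) (1 / (4 * A)))"
  define c' where "c' = min c (1 / 2)"
  have C: "1 \<le> C" "4 * A \<le> C" "1 / (4 * A) \<le> C" and c': "0 < c'" "c' \<le> c" "c' \<le> 1 / 2"
    using assms(5) by (auto simp: C_def c'_def)
  let "\<exists>C>0. \<exists>c'>0. \<forall>n\<ge>1. \<forall>\<epsilon>\<in>{0..1}. ?claim C c' n \<epsilon>" = ?thesis
  have main: "?claim C c' n \<epsilon>"
    if n: "n \<ge> 1" and \<epsilon>: "\<epsilon> \<in> {0..1}" for n \<epsilon>
  proof -
    let ?w = "modulus \<epsilon> (\<Theta> n) (P n) (L n)"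
    let ?p = "minimax_prob n (S n) (D n) (\<Theta> n) (P n) (L n)"
    have nonempty: "\<Theta> n \<noteq> {}" and P: "\<And>\<theta>. \<theta> \<in> \<Theta> n \<Longrightarrow> P n \<theta> \<in> space (prob_algebra (S n))"
      using assms(1)[OF n] by (auto simp: statistical_experiment_def)
    note loss = assms(2)[OF n] and tri = assms(4)[OF n]
    have w0: "0 \<le> ?w"
      by (rule modulus_nonneg[OF \<epsilon> nonempty loss])
    have below: "ennreal c' \<le> ?p \<epsilon> m" if "ereal (2 * A * m) < ?w" for m
      using minimax_prob_ge_half_below_modulus[OF \<epsilon> P loss tri assms(3) that] c'(3)
      by (meson ennreal_leI order_trans)
    show ?thesis
    proof (intro conjI impI allI)
      fix m :: real assume "?w = \<infinity>"
      then show "ennreal c' \<le> ?p \<epsilon> m"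
        by (intro below) simp
    next
      assume "?w < \<infinity>"
      with w0 obtain w where w: "?w = ereal w" "0 \<le> w"
        by (cases ?w) auto
      show "\<exists>M::real. ereal M \<le> ereal C * max (ereal (M0 n)) ?w \<and>
          max (ereal (M0 n)) ?w \<le> ereal C * ereal M \<and> ennreal c' \<le> ?p \<epsilon> M"
      proof (cases "w \<le> M0 n")
        case True
        have "ennreal c' \<le> ennreal c"
          using c'(2) by (rule ennreal_leI)
        also have "\<dots> \<le> ?p 0 (M0 n)"
          using assms(6)[OF n] .
        also have "\<dots> \<le> ?p \<epsilon> (M0 n)"
          by (rule minimax_prob_mono_contamination[OF \<epsilon> P])
        finally have "ennreal c' \<le> ?p \<epsilon> (M0 n)" .
        moreover have "M0 n \<le> C * M0 n"
          using True w(2) C(1) by (simp add: mult_le_cancel_right1)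
        ultimately show ?thesis
          using True by (intro exI[of _ "M0 n"]) (simp add: w(1) max_absorb1)
      next
        case False
        define m where "m = w / (4 * A)"
        have "ennreal c' \<le> ?p \<epsilon> m"
        \<comment> \<open>For \<open>w = 0\<close> there is no pair with positive loss, but the threshold is also \<open>0\<close>, and a pair of
            equal parameters will do.\<close>
        proof (cases "w = 0")
          case True
          obtain \<theta> where \<theta>: "\<theta> \<in> \<Theta> n" using nonempty by auto
          have "2 * A * m \<le> L n \<theta> \<theta>"
            using True \<theta> loss by (auto simp: m_def loss_function_def)
          then have "ennreal (1 / 2) \<le> ?p \<epsilon> m"
            using P TV_self_le_threshold[OF \<epsilon>]
            by (intro minimax_prob_ge_half[OF \<epsilon> _ loss tri assms(3) \<theta> \<theta>]) auto
          then show ?thesis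
            using c'(3) by (meson ennreal_leI order_trans)
        next
          case False
          then show ?thesis
            using w assms(3) by (intro below) (simp add: m_def)
        qed
        moreover have "m \<le> C * w"
          using mult_right_mono[OF C(3) w(2)] by (simp add: m_def)
        moreover have "w \<le> C * m"
          using mult_right_mono[OF C(2), of m] w(2) assms(3) by (simp add: m_def)
        ultimately show ?thesis
          using False by (intro exI[of _ m]) (simp add: w(1) max_absorb2)
      qed
    qed
  qed
  have "\<forall>n\<ge>1. \<forall>\<epsilon>\<in>{0..1}. ?claim C c' n \<epsilon>"
    by (intro allI impI ballI main)
  moreover have "0 < C"
    using C(1) by simp
  ultimately show ?thesis
    using c'(1) by blast
qed

end
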